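(* If $G_1$ and $G_2$ are nontrivial finite groups, then $\iota(G_1\times G_2)\leq \iota(G_1)+\iota(G_2)$.
   Context: All groups are finite. The Frattini subgroup $\Phi(G)$ is the intersection of all maximal subgroups of $G$. For a nontrivial group $G$, the intersection number $\iota(G)$ is the minimum number of maximal subgroups of $G$ whose intersection equals $\Phi(G)$. *)

theory Defs
  imports "HOL-Algebra.Elementary_Groups"
begin

definition maximal_subgroup :: "'a set \<Rightarrow> ('a, 'm) monoid_scheme \<Rightarrow> bool" where
  "maximal_subgroup M G \<longleftrightarrow>
     subgroup M G \<and> M \<noteq> carrier G \<and>
     (\<forall>H. subgroup H G \<longrightarrow> M \<subseteq> H \<longrightarrow> H = M \<or> H = carrier G)"

(* Intersections are taken inside the carrier, so that the intersection of the empty family of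
   subgroups is the whole group rather than the whole type. *)
definition frattini :: "('a, 'm) monoid_scheme \<Rightarrow> 'a set" where
  "frattini G = carrier G \<inter> \<Inter> {M. maximal_subgroup M G}"

(* For finite G the set of admissible n is nonempty, by intersection_number_witness. *)
definition intersection_number :: "('a, 'm) monoid_scheme \<Rightarrow> nat" where
  "intersection_number G =
     (LEAST n. \<exists>\<M>. \<M> \<subseteq> {M. maximal_subgroup M G} \<and> finite \<M> \<and> card \<M> = n \<and>
                   carrier G \<inter> \<Inter> \<M> = frattini G)"

lemma intersection_number_witness:
  assumes "finite (carrier G)"
  shows "\<exists>n \<M>. \<M> \<subseteq> {M. maximal_subgroup M G} \<and> finite \<M> \<and> card \<M> = n \<and>
                carrier G \<inter> \<Inter> \<M> = frattini G"
proof -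
  have "{M. maximal_subgroup M G} \<subseteq> Pow (carrier G)"
    by (auto simp: maximal_subgroup_def dest: subgroup.subset)
  then have "finite {M. maximal_subgroup M G}"
    using assms by (meson finite_Pow_iff finite_subset)
  then show ?thesis
    unfolding frattini_def by blast
qed

end

theory Submission
  imports Defs "HOL-Algebra.Zassenhaus"
begin

text \<open>
  Sending a maximal subgroup \<open>M\<close> of the first factor to \<open>M \<times> G\<^sub>2\<close>, and a maximal subgroup \<open>N\<close> of
  the second one to \<open>G\<^sub>1 \<times> N\<close>, turns optimal families for the factors into a family of maximal
  subgroups of the product whose intersection is \<open>\<Phi>(G\<^sub>1) \<times> \<Phi>(G\<^sub>2)\<close>. It remains to see that this is
  \<open>\<Phi>(G\<^sub>1 \<times> G\<^sub>2)\<close>. The nontrivial inclusion follows from \<open>\<Phi>(N) \<le> \<Phi>(G)\<close> for normal \<open>N\<close>: if a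
  maximal \<open>M\<close> misses \<open>\<Phi>(N)\<close>, then \<open>\<Phi>(N) M = G\<close>, so \<open>\<Phi>(N) (N \<inter> M) = N\<close> by Dedekind, hence
  \<open>N \<subseteq> M\<close> because \<open>\<Phi>(N)\<close> consists of non-generators, a contradiction.
\<close>

section \<open>Transport of maximal subgroups along isomorphisms\<close>

lemma maximal_subgroupD:
  assumes "maximal_subgroup M G"
  shows "subgroup M G" "M \<noteq> carrier G"
    "\<And>H. subgroup H G \<Longrightarrow> M \<subseteq> H \<Longrightarrow> H = M \<or> H = carrier G"
  using assms by (auto simp: maximal_subgroup_def)

lemma (in group) maximal_subgroup_iso_image:
  assumes H: "group H" and f: "f \<in> iso G H" and M: "maximal_subgroup M G"
  shows "maximal_subgroup (f ` M) H"
proof -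
  have bij: "bij_betw f (carrier G) (carrier H)"
    using f by (simp add: iso_def)
  define g where "g = inv_into (carrier G) f"
  have g: "g \<in> iso H G"
    using iso_set_sym[OF f] by (simp add: g_def)
  have MG: "M \<subseteq> carrier G"
    using maximal_subgroupD(1)[OF M] by (rule subgroup.subset)
  have "f ` M \<noteq> carrier H"
    using maximal_subgroupD(2)[OF M] MG bij
    by (metis bij_betw_def inj_on_image_eq_iff order_refl)
  moreover have "K = f ` M \<or> K = carrier H" if K: "subgroup K H" "f ` M \<subseteq> K" for K
  proof -
    have KH: "K \<subseteq> carrier H"
      using K(1) by (rule subgroup.subset)
    have "subgroup (g ` K) G"
      using subgroup.iso_subgroup[OF K(1) H is_group g] .
    moreover have "M \<subseteq> g ` K"
    proof
      fix x assume "x \<in> M"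
      then have "g (f x) = x" "f x \<in> K"
        using K(2) MG bij by (auto simp: g_def bij_betw_def inv_into_f_f)
      then show "x \<in> g ` K" by force
    qed
    ultimately have "g ` K = M \<or> g ` K = carrier G"
      by (rule maximal_subgroupD(3)[OF M])
    moreover have "f ` g ` K = K"
      using KH bij unfolding g_def bij_betw_def by (metis image_inv_into_cancel)
    moreover have "f ` carrier G = carrier H"
      using bij by (simp add: bij_betw_def)
    ultimately show ?thesis by metis
  qed
  moreover have "subgroup (f ` M) H"
    using subgroup.iso_subgroup[OF maximal_subgroupD(1)[OF M] is_group H f] .
  ultimately show ?thesis
    by (simp add: maximal_subgroup_def)
qed

text \<open>The inverse of \<open>f\<close> carries each maximal subgroup of \<open>H\<close> to one
  of \<open>G\<close>, which contains \<open>x\<close>. The result serves conjugations, the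
  embedding of a direct factor and the swap of coordinates.\<close>

lemma (in group) frattini_iso_mem:
  assumes H: "group H" and f: "f \<in> iso G H" and x: "x \<in> frattini G"
  shows "f x \<in> frattini H"
proof -
  have bij: "bij_betw f (carrier G) (carrier H)"
    using f by (simp add: iso_def)
  define g where "g = inv_into (carrier G) f"
  have g: "g \<in> iso H G"
    using iso_set_sym[OF f] by (simp add: g_def)
  have xG: "x \<in> carrier G"
    using x by (simp add: frattini_def)
  have "f x \<in> M" if M: "maximal_subgroup M H" for M
  proof -
    have "maximal_subgroup (g ` M) G"
      using group.maximal_subgroup_iso_image[OF H is_group g M] .
    then have "x \<in> g ` M"
      using x by (auto simp: frattini_def)
    then obtain y where y: "y \<in> M" "x = g y" by blast
    then have "y \<in> carrier H"
      using maximal_subgroupD(1)[OF M] subgroup.mem_carrier by metis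
    then have "f x = y"
      using bij y(2) by (metis bij_betw_inv_into_right g_def)
    then show ?thesis using y(1) by simp
  qed
  moreover have "f x \<in> carrier H"
    using xG bij by (auto simp: bij_betw_def)
  ultimately show ?thesis
    by (auto simp: frattini_def)
qed

section \<open>The Frattini subgroup of a normal subgroup\<close>

lemma ex_maximal_subgroup_supset:
  assumes "finite (carrier G)" and "subgroup H G" and "H \<noteq> carrier G"
  shows "\<exists>M. maximal_subgroup M G \<and> H \<subseteq> M"
proof -
  let ?A = "{K. subgroup K G \<and> K \<noteq> carrier G}"
  have "?A \<subseteq> Pow (carrier G)"
    by (auto dest: subgroup.subset)
  then have "finite ?A"
    using assms(1) by (meson finite_Pow_iff finite_subset)
  then obtain M where "M \<in> ?A" "H \<subseteq> M" "\<forall>K\<in>?A. M \<subseteq> K \<longrightarrow> M = K"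
    using finite_has_maximal2[of ?A H] assms(2,3) by blast
  then show ?thesis
    unfolding maximal_subgroup_def by blast
qed

lemma (in group) frattini_subgroup: "subgroup (frattini G) G"
proof -
  \<comment> \<open>Inserting the carrier replaces the outer intersection in \<open>frattini\<close>
    and makes the family nonempty, as \<open>subgroups_Inter\<close> demands.\<close>
  have "subgroup (\<Inter> (insert (carrier G) {M. maximal_subgroup M G})) G"
    by (rule subgroups_Inter) (auto simp: subgroup_self maximal_subgroup_def)
  then show ?thesis
    by (simp add: frattini_def)
qed

lemma (in group) conjugation_iso_normal:
  assumes N: "N \<lhd> G" and g: "g \<in> carrier G"
  shows "(\<lambda>x. g \<otimes> x \<otimes> inv g) \<in> iso (G\<lparr>carrier := N\<rparr>) (G\<lparr>carrier := N\<rparr>)"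
proof (rule isoI)
  have NG: "N \<subseteq> carrier G"
    using N by (simp add: normal_imp_subgroup subgroup.subset)
  show "(\<lambda>x. g \<otimes> x \<otimes> inv g) \<in> hom (G\<lparr>carrier := N\<rparr>) (G\<lparr>carrier := N\<rparr>)"
  proof (rule homI)
    fix x y assume "x \<in> carrier (G\<lparr>carrier := N\<rparr>)" "y \<in> carrier (G\<lparr>carrier := N\<rparr>)"
    then have xy: "x \<in> carrier G" "y \<in> carrier G"
      using NG by auto
    \<comment> \<open>This is the one cancellation left once \<open>m_assoc\<close> has bracketed
      both sides to the right.\<close>
    then have "inv g \<otimes> (g \<otimes> (y \<otimes> inv g)) = y \<otimes> inv g"
      using g by (simp add: inv_solve_left')
    then show "g \<otimes> (x \<otimes>\<^bsub>G\<lparr>carrier := N\<rparr>\<^esub> y) \<otimes> inv g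
        = (g \<otimes> x \<otimes> inv g) \<otimes>\<^bsub>G\<lparr>carrier := N\<rparr>\<^esub> (g \<otimes> y \<otimes> inv g)"
      using xy g by (simp add: m_assoc)
  qed (use N g in \<open>simp add: normal.inv_op_closed2\<close>)
  show "bij_betw (\<lambda>x. g \<otimes> x \<otimes> inv g) (carrier (G\<lparr>carrier := N\<rparr>)) (carrier (G\<lparr>carrier := N\<rparr>))"
  proof (rule bij_betw_byWitness[where f' = "\<lambda>x. inv g \<otimes> x \<otimes> g"])
    have "inv g \<otimes> (g \<otimes> x \<otimes> inv g) \<otimes> g = x \<and> g \<otimes> (inv g \<otimes> x \<otimes> g) \<otimes> inv g = x"
      if "x \<in> carrier G" for x
      using that g by (metis inv_closed inv_solve_left' inv_solve_right' m_closed m_assoc)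
    then show "\<forall>x\<in>carrier (G\<lparr>carrier := N\<rparr>). inv g \<otimes> (g \<otimes> x \<otimes> inv g) \<otimes> g = x"
      and "\<forall>x\<in>carrier (G\<lparr>carrier := N\<rparr>). g \<otimes> (inv g \<otimes> x \<otimes> g) \<otimes> inv g = x"
      using NG by auto
  qed (use N g in \<open>auto simp: normal.inv_op_closed1 normal.inv_op_closed2\<close>)
qed

text \<open>The Frattini subgroup is invariant under automorphisms, and conjugation by any element
  of \<open>G\<close> restricts to an automorphism of \<open>N\<close>.\<close>

lemma (in group) frattini_normal_subgroup:
  assumes N: "N \<lhd> G"
  shows "frattini (G\<lparr>carrier := N\<rparr>) \<lhd> G"
proof -
  have sub: "subgroup N G"
    using N by (rule normal_imp_subgroup)
  interpret N: group "G\<lparr>carrier := N\<rparr>"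
    using subgroup.subgroup_is_group[OF sub is_group] .
  have "subgroup (frattini (G\<lparr>carrier := N\<rparr>)) G"
    using incl_subgroup[OF sub N.frattini_subgroup] .
  then show ?thesis
    unfolding normal_inv_iff
    using N.frattini_iso_mem[OF N.is_group conjugation_iso_normal[OF N]] by blast
qed

lemma (in group) frattini_normal_mono:
  assumes fin: "finite (carrier G)" and N: "N \<lhd> G"
  shows "frattini (G\<lparr>carrier := N\<rparr>) \<subseteq> frattini G"
proof -
  let ?F = "frattini (G\<lparr>carrier := N\<rparr>)"
  have sub: "subgroup N G"
    using N by (rule normal_imp_subgroup)
  interpret N: group "G\<lparr>carrier := N\<rparr>"
    using subgroup.subgroup_is_group[OF sub is_group] .
  have NG: "N \<subseteq> carrier G"
    using sub by (rule subgroup.subset)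
  have FN: "?F \<subseteq> N"
    by (simp add: frattini_def)
  have F: "?F \<lhd> G"
    using frattini_normal_subgroup[OF N] .
  have Fsub: "subgroup ?F G"
    using F by (rule normal_imp_subgroup)
  have "?F \<subseteq> M" if M: "maximal_subgroup M G" for M
  proof (rule ccontr)
    assume not_sub: "\<not> ?F \<subseteq> M"
    have Msub: "subgroup M G"
      using M by (rule maximal_subgroupD)
    have MG: "M \<subseteq> carrier G"
      using Msub by (rule subgroup.subset)
    have "M \<subseteq> ?F <#> M"
    proof
      fix x assume "x \<in> M"
      then have "x = \<one> \<otimes> x" using MG by auto
      then show "x \<in> ?F <#> M"
        using \<open>x \<in> M\<close> subgroup.one_closed[OF Fsub] unfolding set_mult_def by blast
    qed
    moreover have "?F \<subseteq> ?F <#> M"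
    proof
      fix x assume "x \<in> ?F"
      then have "x = x \<otimes> \<one>" using FN NG by auto
      then show "x \<in> ?F <#> M"
        using \<open>x \<in> ?F\<close> subgroup.one_closed[OF Msub] unfolding set_mult_def by blast
    qed
    \<comment> \<open>The product is a subgroup because \<open>?F\<close> is normal in
      \<open>G\<close>. It contains \<open>M\<close> and also \<open>?F\<close>, so it is strictly
      larger than \<open>M\<close>.\<close>
    ultimately have FM: "?F <#> M = carrier G"
      using maximal_subgroupD(3)[OF M mult_norm_subgroup[OF F Msub]] not_sub by blast
    have "N \<inter> M = N"
    proof (rule ccontr)
      assume "N \<inter> M \<noteq> N"
      moreover have "subgroup (N \<inter> M) (G\<lparr>carrier := N\<rparr>)"
        using subgroup_incl[OF subgroups_Inter_pair[OF sub Msub] sub] by simp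
      \<comment> \<open>If \<open>N \<inter> M\<close> were proper in \<open>N\<close>, some maximal
        subgroup \<open>L\<close> of \<open>N\<close> would contain it. As \<open>L\<close> also
        contains \<open>?F\<close>, it would contain the product of the two, which is all of
        \<open>N\<close>.\<close>
      ultimately obtain L where L: "maximal_subgroup L (G\<lparr>carrier := N\<rparr>)" "N \<inter> M \<subseteq> L"
        using ex_maximal_subgroup_supset[of "G\<lparr>carrier := N\<rparr>" "N \<inter> M"] finite_subset[OF NG fin]
        by auto
      have FL: "?F \<subseteq> L"
        using L(1) by (auto simp: frattini_def)
      have Lsub: "subgroup L G"
        using incl_subgroup[OF sub maximal_subgroupD(1)[OF L(1)]] .
      have "N \<subseteq> L"
      proof
        fix x assume x: "x \<in> N"
        then obtain f m where fm: "f \<in> ?F" "m \<in> M" "x = f \<otimes> m"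
          using FM NG unfolding set_mult_def by blast
        \<comment> \<open>Dedekind's law elementwise: \<open>f\<close> and \<open>x\<close> lie in
          \<open>N\<close>, hence so does \<open>m\<close>, and thus \<open>m\<close> lies in
          \<open>N \<inter> M\<close>.\<close>
        then have "m = inv f \<otimes> x"
          using FN NG MG by (metis inv_solve_left subsetD x)
        then have "m \<in> N"
          using fm(1) FN x by (metis subgroupE(3,4)[OF sub] subsetD)
        then show "x \<in> L"
          using fm FL L(2) subgroup.m_closed[OF Lsub] by blast
      qed
      then show False
        using maximal_subgroupD(2)[OF L(1)] subgroup.subset[OF maximal_subgroupD(1)[OF L(1)]]
        by auto
    qed
    then show False
      using FN not_sub by blast
  qed
  then show ?thesis
    using FN NG by (auto simp: frattini_def)
qed

section \<open>Maximal subgroups and the Frattini subgroup of a direct product\<close>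

lemma frattini_DirProd_fst:
  assumes G: "group G" "finite (carrier G)" and H: "group H" "finite (carrier H)"
    and x: "x \<in> frattini G"
  shows "(x, \<one>\<^bsub>H\<^esub>) \<in> frattini (G \<times>\<times> H)"
proof -
  interpret G: group G by fact
  interpret H: group H by fact
  interpret GH: group "G \<times>\<times> H"
    using DirProd_group[OF G(1) H(1)] .
  let ?N = "carrier G \<times> {\<one>\<^bsub>H\<^esub>}"
  have N: "?N \<lhd> G \<times>\<times> H"
    unfolding GH.normal_inv_iff
    using DirProd_subgroups[OF G(1) G.subgroup_self H(1) H.triv_subgroup]
    by (auto simp: G(1) H(1))
  \<comment> \<open>The first factor is identified with the normal subgroup \<open>?N\<close>, so
    that the comparison for normal subgroups applies.\<close>
  have "(\<lambda>x. (x, \<one>\<^bsub>H\<^esub>)) \<in> iso G ((G \<times>\<times> H)\<lparr>carrier := ?N\<rparr>)"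
    by (auto simp: iso_def hom_def bij_betw_def inj_on_def)
  then have "(x, \<one>\<^bsub>H\<^esub>) \<in> frattini ((G \<times>\<times> H)\<lparr>carrier := ?N\<rparr>)"
    using G.frattini_iso_mem x GH.subgroup_imp_group[OF normal_imp_subgroup[OF N]] by blast
  then show ?thesis
    using GH.frattini_normal_mono[OF _ N] G(2) H(2) by auto
qed

lemma frattini_DirProd_snd:
  assumes G: "group G" "finite (carrier G)" and H: "group H" "finite (carrier H)"
    and y: "y \<in> frattini H"
  shows "(\<one>\<^bsub>G\<^esub>, y) \<in> frattini (G \<times>\<times> H)"
  using group.frattini_iso_mem[OF DirProd_group[OF H(1) G(1)] DirProd_group[OF G(1) H(1)]
      DirProd_commute_iso_set frattini_DirProd_fst[OF H G y]]
  by simp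

text \<open>A subgroup of the product that contains the whole second factor is a product
  \<open>P \<times> carrier H\<close>, so the subgroups above \<open>M \<times> carrier H\<close>
  correspond to the subgroups of \<open>G\<close> above \<open>M\<close>.\<close>

lemma maximal_subgroup_DirProd_fst:
  assumes G: "group G" and H: "group H" and M: "maximal_subgroup M G"
  shows "maximal_subgroup (M \<times> carrier H) (G \<times>\<times> H)"
proof -
  interpret G: group G by fact
  interpret H: group H by fact
  interpret GH: group "G \<times>\<times> H"
    using DirProd_group[OF G H] .
  have Msub: "subgroup M G"
    using M by (rule maximal_subgroupD)
  have MG: "M \<subseteq> carrier G"
    using Msub by (rule subgroup.subset)
  have "K = M \<times> carrier H \<or> K = carrier (G \<times>\<times> H)"
    if K: "subgroup K (G \<times>\<times> H)" "M \<times> carrier H \<subseteq> K" for K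
  proof -
    define P where "P = {x. (x, \<one>\<^bsub>H\<^esub>) \<in> K}"
    have KGH: "K \<subseteq> carrier G \<times> carrier H"
      using subgroup.subset[OF K(1)] by simp
    have PG: "P \<subseteq> carrier G"
      using KGH by (auto simp: P_def)
    have MP: "M \<subseteq> P"
      using K(2) by (auto simp: P_def)
    have "subgroup P G"
    proof (rule G.subgroupI)
      show "P \<noteq> {}"
        using MP subgroup.one_closed[OF Msub] by blast
    next
      fix x assume "x \<in> P"
      then show "inv\<^bsub>G\<^esub> x \<in> P"
        using subgroup.m_inv_closed[OF K(1), of "(x, \<one>\<^bsub>H\<^esub>)"] PG G H
        by (auto simp: P_def)
    next
      fix x y assume "x \<in> P" "y \<in> P"
      then show "x \<otimes>\<^bsub>G\<^esub> y \<in> P"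
        using subgroup.m_closed[OF K(1), of "(x, \<one>\<^bsub>H\<^esub>)" "(y, \<one>\<^bsub>H\<^esub>)"]
        by (simp add: P_def)
    qed (fact PG)
    then have "P = M \<or> P = carrier G"
      using MP by (rule maximal_subgroupD(3)[OF M])
    moreover have "K = P \<times> carrier H"
    proof -
      have one: "(\<one>\<^bsub>G\<^esub>, y) \<in> K" if "y \<in> carrier H" for y
        using K(2) that subgroup.one_closed[OF Msub] by blast
      \<comment> \<open>Multiplying by \<open>(\<one>, y)\<close> or by its inverse, both in
        \<open>K\<close>, moves between \<open>(x, \<one>)\<close> and
        \<open>(x, y)\<close>.\<close>
      have "(x, y) \<in> K \<longleftrightarrow> x \<in> P" if xy: "x \<in> carrier G" "y \<in> carrier H" for x y
        using subgroup.m_closed[OF K(1) _ one[OF xy(2)], of "(x, \<one>\<^bsub>H\<^esub>)"]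
          subgroup.m_closed[OF K(1) _ one[OF H.inv_closed[OF xy(2)]], of "(x, y)"] xy
        by (auto simp: P_def)
      then show ?thesis
        using KGH PG by auto
    qed
    ultimately show ?thesis by auto
  qed
  \<comment> \<open>The second factor can be cancelled only because it is nonempty, hence the appeal
    to \<open>H.one_closed\<close>.\<close>
  moreover have "M \<times> carrier H \<noteq> carrier (G \<times>\<times> H)"
    using maximal_subgroupD(2)[OF M] H.one_closed by (auto simp: times_eq_iff)
  moreover have "subgroup (M \<times> carrier H) (G \<times>\<times> H)"
    using DirProd_subgroups[OF G Msub H H.subgroup_self] .
  ultimately show ?thesis
    by (simp add: maximal_subgroup_def)
qed

lemma maximal_subgroup_DirProd_snd:
  assumes G: "group G" and H: "group H" and M: "maximal_subgroup M H"
  shows "maximal_subgroup (carrier G \<times> M) (G \<times>\<times> H)"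
proof -
  have "maximal_subgroup ((\<lambda>(x, y). (y, x)) ` (M \<times> carrier G)) (G \<times>\<times> H)"
    using group.maximal_subgroup_iso_image[OF DirProd_group[OF H G] DirProd_group[OF G H]
        DirProd_commute_iso_set maximal_subgroup_DirProd_fst[OF H G M]] .
  moreover have "(\<lambda>(x, y). (y, x)) ` (M \<times> carrier G) = carrier G \<times> M"
    by auto
  ultimately show ?thesis by simp
qed

lemma frattini_DirProd:
  assumes G: "group G" "finite (carrier G)" and H: "group H" "finite (carrier H)"
  shows "frattini (G \<times>\<times> H) = frattini G \<times> frattini H"
proof
  \<comment> \<open>The maximal subgroups of the two product shapes already confine each coordinate
    to the Frattini subgroup of its factor.\<close>
  show "frattini (G \<times>\<times> H) \<subseteq> frattini G \<times> frattini H"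
    using maximal_subgroup_DirProd_fst[OF G(1) H(1)] maximal_subgroup_DirProd_snd[OF G(1) H(1)]
    unfolding frattini_def by auto
next
  interpret G: group G by fact
  interpret H: group H by fact
  interpret GH: group "G \<times>\<times> H"
    using DirProd_group[OF G(1) H(1)] .
  show "frattini G \<times> frattini H \<subseteq> frattini (G \<times>\<times> H)"
  proof clarify
    fix x y assume xy: "x \<in> frattini G" "y \<in> frattini H"
    then have "x \<in> carrier G" "y \<in> carrier H"
      by (auto simp: frattini_def)
    \<comment> \<open>The pair is the product of \<open>(x, \<one>)\<close> and
      \<open>(\<one>, y)\<close>.\<close>
    then show "(x, y) \<in> frattini (G \<times>\<times> H)"
      using subgroup.m_closed[OF GH.frattini_subgroup
          frattini_DirProd_fst[OF G H xy(1)] frattini_DirProd_snd[OF G H xy(2)]]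
      by simp
  qed
qed

section \<open>Optimal families and the inequality\<close>

lemma intersection_number_attained:
  assumes "finite (carrier G)"
  obtains \<M> where "\<M> \<subseteq> {M. maximal_subgroup M G}" "finite \<M>"
    "card \<M> = intersection_number G" "carrier G \<inter> \<Inter> \<M> = frattini G"
  using LeastI_ex[OF intersection_number_witness[OF assms]]
  unfolding intersection_number_def by blast

lemma intersection_number_le_card:
  assumes "\<M> \<subseteq> {M. maximal_subgroup M G}" "finite \<M>" "carrier G \<inter> \<Inter> \<M> = frattini G"
  shows "intersection_number G \<le> card \<M>"
  unfolding intersection_number_def by (rule Least_le) (use assms in blast)

theorem proposition2p1:
  fixes G\<^sub>1 :: "('a, 'm) monoid_scheme" and G\<^sub>2 :: "('b, 'n) monoid_scheme"
  assumes "group G\<^sub>1" and "finite (carrier G\<^sub>1)" and "\<not> trivial_group G\<^sub>1"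
    and "group G\<^sub>2" and "finite (carrier G\<^sub>2)" and "\<not> trivial_group G\<^sub>2"
  shows "intersection_number (G\<^sub>1 \<times>\<times> G\<^sub>2) \<le> intersection_number G\<^sub>1 + intersection_number G\<^sub>2"
proof -
  obtain \<A> where A: "\<A> \<subseteq> {M. maximal_subgroup M G\<^sub>1}" "finite \<A>"
    "card \<A> = intersection_number G\<^sub>1" "carrier G\<^sub>1 \<inter> \<Inter> \<A> = frattini G\<^sub>1"
    using intersection_number_attained[OF assms(2)] .
  obtain \<B> where B: "\<B> \<subseteq> {M. maximal_subgroup M G\<^sub>2}" "finite \<B>"
    "card \<B> = intersection_number G\<^sub>2" "carrier G\<^sub>2 \<inter> \<Inter> \<B> = frattini G\<^sub>2"
    using intersection_number_attained[OF assms(5)] .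
  let ?\<A> = "(\<lambda>M. M \<times> carrier G\<^sub>2) ` \<A>" and ?\<B> = "(\<lambda>M. carrier G\<^sub>1 \<times> M) ` \<B>"
  \<comment> \<open>Each member constrains a single coordinate, so the intersection is a
    rectangle.\<close>
  have "carrier (G\<^sub>1 \<times>\<times> G\<^sub>2) \<inter> \<Inter> (?\<A> \<union> ?\<B>)
      = (carrier G\<^sub>1 \<inter> \<Inter> \<A>) \<times> (carrier G\<^sub>2 \<inter> \<Inter> \<B>)"
    by auto
  then have "carrier (G\<^sub>1 \<times>\<times> G\<^sub>2) \<inter> \<Inter> (?\<A> \<union> ?\<B>) = frattini (G\<^sub>1 \<times>\<times> G\<^sub>2)"
    using A(4) B(4) frattini_DirProd[OF assms(1,2,4,5)] by simp
  moreover have "?\<A> \<union> ?\<B> \<subseteq> {M. maximal_subgroup M (G\<^sub>1 \<times>\<times> G\<^sub>2)}"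
    using A(1) B(1) maximal_subgroup_DirProd_fst[OF assms(1,4)]
      maximal_subgroup_DirProd_snd[OF assms(1,4)] by blast
  moreover have "finite (?\<A> \<union> ?\<B>)"
    using A(2) B(2) by simp
  ultimately have "intersection_number (G\<^sub>1 \<times>\<times> G\<^sub>2) \<le> card (?\<A> \<union> ?\<B>)"
    by (intro intersection_number_le_card)
  also have "\<dots> \<le> card ?\<A> + card ?\<B>"
    by (rule card_Un_le)
  also have "\<dots> \<le> card \<A> + card \<B>"
    using A(2) B(2) by (intro add_mono card_image_le)
  finally show ?thesis
    by (simp add: A(3) B(3))
qed

end
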